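(* Let $E$ and $F$ be Banach spaces, with $E$ reflexive and densely and continuously embedded in $F$, and let $T>0$. Then $$L^\infty(0,T;E)\cap D_w([0,T];F)=D_w([0,T];E).$$
   Context: For a Banach space $G$, $D_w([0,T];G)$ is the space of weakly càdlàg functions $u:[0,T]\to G$, i.e. functions that are right-continuous with left limits with respect to the weak topology of $G$. $L^\infty(0,T;E)$ is the usual Lebesgue–Bochner space of essentially bounded $E$-valued functions on $(0,T)$.
   Formalization: As sets of functions on [0,T], the equality is stated with the added condition u(T) in E on the left side, since a weakly càdlàg function may take any value at T; as sets of classes modulo a.e. equality on (0,T) it is stated without this condition. *)

theory Defs
  imports "HOL-Analysis.Analysis"
begin

definition bidual_embedding :: "'a::real_normed_vector \<Rightarrow> ('a \<Rightarrow>\<^sub>L real) \<Rightarrow>\<^sub>L real" where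
  "bidual_embedding x = Blinfun (\<lambda>\<phi>. blinfun_apply \<phi> x)"

definition reflexive_space :: "'a::real_normed_vector itself \<Rightarrow> bool" where
  "reflexive_space _ \<longleftrightarrow> surj (bidual_embedding :: 'a \<Rightarrow> ('a \<Rightarrow>\<^sub>L real) \<Rightarrow>\<^sub>L real)"

definition weak_topology :: "'a::real_normed_vector topology" where
  "weak_topology = topology_generated_by
     {blinfun_apply \<phi> -` U | (\<phi> :: 'a \<Rightarrow>\<^sub>L real) U. open U}"

definition dense_continuous_embedding :: "('a::real_normed_vector \<Rightarrow> 'b::real_normed_vector) \<Rightarrow> bool" where
  "dense_continuous_embedding i \<longleftrightarrow> bounded_linear i \<and> inj i \<and> closure (range i) = UNIV"

text \<open>The functions \<open>[0,T] \<rightarrow> G\<close> that are right-continuous with left limits for the weak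
  topology, not identified almost everywhere; outside \<open>[0,T]\<close> they are \<open>undefined\<close>. There is no
  condition from the right at \<open>T\<close>, so the value at \<open>T\<close> is arbitrary.\<close>

definition Dw :: "real \<Rightarrow> (real \<Rightarrow> 'a::real_normed_vector) set" where
  "Dw T = {u \<in> extensional {0..T}.
     (\<forall>t\<in>{0..<T}. limitin weak_topology u (u t) (at_right t)) \<and>
     (\<forall>t\<in>{0<..T}. \<exists>l. limitin weak_topology u l (at_left t))}"

text \<open>Bochner (strong) measurability. For non-separable spaces this is stronger than
  \<open>borel_measurable\<close>.\<close>

definition strongly_measurable :: "'a measure \<Rightarrow> ('a \<Rightarrow> 'b::real_normed_vector) \<Rightarrow> bool" where
  "strongly_measurable M v \<longleftrightarrow>
     (\<exists>s :: nat \<Rightarrow> 'a \<Rightarrow> 'b. (\<forall>n. simple_function M (s n)) \<and> (AE t in M. (\<lambda>n. s n t) \<longlonglongrightarrow> v t))"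

definition Linf_functions :: "real \<Rightarrow> (real \<Rightarrow> 'a::real_normed_vector) set" where
  "Linf_functions T = {v. strongly_measurable (lebesgue_on {0<..<T}) v \<and>
     (\<exists>C. AE t in lebesgue_on {0<..<T}. norm (v t) \<le> C)}"

text \<open>The class of \<open>u\<close> modulo equality almost everywhere on \<open>(0,T)\<close>.\<close>

definition ae_class :: "real \<Rightarrow> (real \<Rightarrow> 'a) \<Rightarrow> (real \<Rightarrow> 'a) set" where
  "ae_class T u = {v. AE t in lebesgue_on {0<..<T}. v t = u t}"

text \<open>The space \<open>L\<^sup>\<infinity>(0,T;E)\<close> of classes, regarded through the embedding \<open>i : E \<rightarrow> F\<close> as a set of
  classes of \<open>F\<close>-valued functions.\<close>

definition Linf_via :: "real \<Rightarrow> ('a::real_normed_vector \<Rightarrow> 'b) \<Rightarrow> (real \<Rightarrow> 'b) set set" where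
  "Linf_via T i = (\<lambda>v. ae_class T (i \<circ> v)) ` Linf_functions T"

end

theory Submission
  imports Defs
begin

text \<open>If \<open>E\<close> is reflexive and \<open>i : E \<rightarrow> F\<close> is injective, the functionals \<open>\<phi> \<circ> i\<close> are norm dense in
  the dual of \<open>E\<close>. Hence a net that is bounded by \<open>C\<close> in \<open>E\<close> and converges weakly in \<open>F\<close> converges
  weakly in \<open>E\<close>, to an element of norm at most \<open>C\<close>. For \<open>u\<close> in the left-hand side, applying this
  along times \<open>s \<down> t\<close> outside an exceptional null set shows that all values \<open>u t\<close> with \<open>t < T\<close> lie
  in the ball of radius \<open>C\<close> of \<open>E\<close>; applying it once more to the unrestricted one-sided limits
  gives weak regularity in \<open>E\<close>. Conversely, a weakly cadlag function is bounded by the uniform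
  boundedness principle and strongly measurable by Pettis' argument: its values on \<open>(0,T)\<close> lie in the
  closed span of its values at rational times, and \<open>t \<mapsto> \<parallel>u t - x\<parallel>\<close> is lower semicontinuous from
  the right.\<close>

section \<open>The Hahn--Banach theorem\<close>

definition sublinear :: "('a::real_vector \<Rightarrow> real) \<Rightarrow> bool" where
  "sublinear p \<longleftrightarrow> (\<forall>x y. p (x + y) \<le> p x + p y) \<and> (\<forall>c x. 0 \<le> c \<longrightarrow> p (c *\<^sub>R x) = c * p x)"

lemma sublinear_add: "sublinear p \<Longrightarrow> p (x + y) \<le> p x + p y"
  and sublinear_scaleR: "sublinear p \<Longrightarrow> 0 \<le> c \<Longrightarrow> p (c *\<^sub>R x) = c * p x"
  by (auto simp: sublinear_def)

lemma sublinear_zero: "sublinear p \<Longrightarrow> p 0 = 0"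
  using sublinear_scaleR[of p 0 0] by simp

lemma sublinear_minus: "sublinear p \<Longrightarrow> - p (- x) \<le> p x"
  using sublinear_add[of p x "- x"] sublinear_zero[of p] by simp

text \<open>One inequality for positive factors is enough: used with \<open>inverse c\<close> at the
  point \<open>c *\<^sub>R x\<close>, it yields the opposite one.\<close>

lemma sublinearI:
  assumes add: "\<And>x y. p (x + y) \<le> p x + p y"
    and scale: "\<And>c x. 0 < c \<Longrightarrow> p (c *\<^sub>R x) \<le> c * p x"
    and zero: "p 0 = 0"
  shows "sublinear p"
  unfolding sublinear_def
proof (intro conjI allI impI add)
  fix c :: real and x
  assume "0 \<le> c"
  show "p (c *\<^sub>R x) = c * p x"
  proof (cases "c = 0")
    case False
    with \<open>0 \<le> c\<close> have c: "0 < c" by simp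
    have "p (inverse c *\<^sub>R (c *\<^sub>R x)) \<le> inverse c * p (c *\<^sub>R x)"
      using c by (intro scale) simp
    then have "c * p x \<le> p (c *\<^sub>R x)"
      using c by (simp add: field_simps)
    with scale[OF c, of x] show ?thesis by simp
  qed (simp add: zero)
qed

text \<open>Provides the lower bounds for Zorn's lemma. Every member of the chain is at least
  \<open>- p (- x)\<close> at \<open>x\<close>, so the infimum is finite. For subadditivity, two
  members used at \<open>x\<close> and at \<open>y\<close> are both replaced by the smaller of
  them.\<close>

lemma sublinear_INF_chain:
  assumes p: "sublinear p" and ne: "C \<noteq> {}"
    and C: "\<And>q. q \<in> C \<Longrightarrow> sublinear q \<and> q \<le> p"
    and chain: "\<And>q r. q \<in> C \<Longrightarrow> r \<in> C \<Longrightarrow> q \<le> r \<or> r \<le> q"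
  shows "sublinear (\<lambda>x. INF q\<in>C. q x)" and "\<And>q. q \<in> C \<Longrightarrow> (\<lambda>x. INF q\<in>C. q x) \<le> q"
proof -
  have bdd: "bdd_below ((\<lambda>q. q x) ` C)" for x
  proof (rule bdd_belowI2)
    fix q assume "q \<in> C"
    then show "- p (- x) \<le> q x"
      using sublinear_minus[of q x] C[of q] le_funD[of q p "- x"] by linarith
  qed
  have le: "(INF q\<in>C. q x) \<le> q x" if "q \<in> C" for q x
    by (rule cINF_lower[OF bdd that])
  then show "\<And>q. q \<in> C \<Longrightarrow> (\<lambda>x. INF q\<in>C. q x) \<le> q"
    by (simp add: le_fun_def)
  show "sublinear (\<lambda>x. INF q\<in>C. q x)"
  proof (rule sublinearI)
    fix x y
    have *: "(INF q\<in>C. q (x + y)) \<le> q x + r y" if "q \<in> C" "r \<in> C" for q r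
    proof -
      from chain[OF that] that obtain s where s: "s \<in> C" "s \<le> q" "s \<le> r"
        by blast
      have "(INF q\<in>C. q (x + y)) \<le> s (x + y)"
        by (rule le[OF s(1)])
      also have "\<dots> \<le> s x + s y"
        using C[OF s(1)] by (auto intro: sublinear_add)
      also have "\<dots> \<le> q x + r y"
        using s(2,3) by (intro add_mono) (auto simp: le_fun_def)
      finally show ?thesis .
    qed
    have "(INF q\<in>C. q (x + y)) - r y \<le> (INF q\<in>C. q x)" if "r \<in> C" for r
      using *[OF _ that] by (intro cINF_greatest[OF ne]) (simp add: algebra_simps)
    then have "(INF q\<in>C. q (x + y)) - (INF q\<in>C. q x) \<le> (INF q\<in>C. q y)"
      by (intro cINF_greatest[OF ne]) (simp add: algebra_simps)
    then show "(INF q\<in>C. q (x + y)) \<le> (INF q\<in>C. q x) + (INF q\<in>C. q y)"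
      by simp
  next
    fix c :: real and x :: 'a
    assume c: "0 < c"
    have "(INF q\<in>C. q (c *\<^sub>R x)) / c \<le> (INF q\<in>C. q x)"
    proof (rule cINF_greatest[OF ne])
      fix q assume q: "q \<in> C"
      have "(INF q\<in>C. q (c *\<^sub>R x)) \<le> c * q x"
        using le[OF q, of "c *\<^sub>R x"] sublinear_scaleR[of q c x] C[OF q] c by simp
      then show "(INF q\<in>C. q (c *\<^sub>R x)) / c \<le> q x"
        using c by (simp add: field_simps)
    qed
    then show "(INF q\<in>C. q (c *\<^sub>R x)) \<le> c * (INF q\<in>C. q x)"
      using c by (simp add: field_simps)
  next
    have "(\<lambda>q. q 0) ` C = {0::real}"
      using ne C by (force simp: sublinear_zero)
    then show "(INF q\<in>C. q 0) = (0::real)" by simp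
  qed
qed

text \<open>\<open>r\<close> lowers \<open>q\<close> along the ray in direction \<open>y\<close>;
  subadditivity bounds all terms below by \<open>- q (- x)\<close>. The parameter
  \<open>t = 0\<close> gives \<open>r \<le> q\<close>, and \<open>t = 1\<close> gives the last
  bound, which becomes superadditivity as soon as \<open>r = q\<close>. Sublinearity of
  \<open>r\<close> comes from adding the parameters of two points and from rescaling
  \<open>t\<close> to \<open>c * t\<close>.\<close>

lemma sublinear_tilt:
  fixes q :: "'a::real_vector \<Rightarrow> real" and y :: 'a
  assumes q: "sublinear q"
  defines "r \<equiv> \<lambda>x. INF t\<in>{0..}. q (x + t *\<^sub>R y) - t * q y"
  shows "sublinear r" and "r \<le> q" and "\<And>x. r x \<le> q (x + y) - q y"
proof -
  have bdd: "bdd_below ((\<lambda>t. q (x + t *\<^sub>R y) - t * q y) ` {0..})" for x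
  proof (rule bdd_belowI2)
    fix t :: real assume "t \<in> {0..}"
    then show "- q (- x) \<le> q (x + t *\<^sub>R y) - t * q y"
      using sublinear_add[OF q, of "x + t *\<^sub>R y" "- x"] sublinear_scaleR[OF q, of t y] by simp
  qed
  have le: "r x \<le> q (x + t *\<^sub>R y) - t * q y" if "0 \<le> t" for t x
    unfolding r_def using that by (intro cINF_lower[OF bdd]) simp
  from le[of 0] show "r \<le> q"
    by (simp add: le_fun_def)
  from le[of 1] show "r x \<le> q (x + y) - q y" for x
    by simp
  have ge: "b \<le> r x" if "\<And>t. 0 \<le> t \<Longrightarrow> b \<le> q (x + t *\<^sub>R y) - t * q y" for b x
    unfolding r_def using that by (intro cINF_greatest) auto
  show "sublinear r"
  proof (rule sublinearI)
    fix x x'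
    have *: "r (x + x') \<le> (q (x + s *\<^sub>R y) - s * q y) + (q (x' + t *\<^sub>R y) - t * q y)"
      if "0 \<le> s" "0 \<le> t" for s t
    proof -
      have "r (x + x') \<le> q ((x + x') + (s + t) *\<^sub>R y) - (s + t) * q y"
        using that by (intro le) simp
      also have "(x + x') + (s + t) *\<^sub>R y = (x + s *\<^sub>R y) + (x' + t *\<^sub>R y)"
        by (simp add: algebra_simps)
      also have "q \<dots> \<le> q (x + s *\<^sub>R y) + q (x' + t *\<^sub>R y)"
        by (rule sublinear_add[OF q])
      finally show ?thesis by (simp add: algebra_simps)
    qed
    have "r (x + x') - (q (x' + t *\<^sub>R y) - t * q y) \<le> r x" if "0 \<le> t" for t
      using *[OF _ that] by (intro ge) (simp add: algebra_simps)
    then have "r (x + x') - r x \<le> r x'"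
      by (intro ge) (simp add: algebra_simps)
    then show "r (x + x') \<le> r x + r x'" by simp
  next
    fix c :: real and x :: 'a
    assume c: "0 < c"
    have "r (c *\<^sub>R x) / c \<le> r x"
    proof (rule ge)
      fix t :: real assume t: "0 \<le> t"
      have "r (c *\<^sub>R x) \<le> q (c *\<^sub>R x + (c * t) *\<^sub>R y) - (c * t) * q y"
        using c t by (intro le) simp
      also have "q (c *\<^sub>R x + (c * t) *\<^sub>R y) = c * q (x + t *\<^sub>R y)"
        using sublinear_scaleR[OF q, of c "x + t *\<^sub>R y"] c by (simp add: algebra_simps)
      finally show "r (c *\<^sub>R x) / c \<le> q (x + t *\<^sub>R y) - t * q y"
        using c by (simp add: field_simps)
    qed
    then show "r (c *\<^sub>R x) \<le> c * r x"
      using c by (simp add: field_simps)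
  next
    show "r 0 = 0"
      using ge[of 0 0] le[of 0 0] by (simp add: sublinear_scaleR[OF q] sublinear_zero[OF q])
  qed
qed

text \<open>A minimal sublinear functional coincides with all its tilts, which makes it additive.\<close>

lemma linear_below_sublinear:
  fixes p :: "'a::real_vector \<Rightarrow> real"
  assumes p: "sublinear p"
  obtains g where "linear g" "g \<le> p"
proof -
  let ?A = "{q. sublinear q \<and> q \<le> p}"
  have "\<exists>m\<in>?A. \<forall>a\<in>?A. a \<le> m \<longrightarrow> a = m"
  \<comment> \<open>The order is reversed, so the maximal element delivered by Zorn's lemma is a
    minimal sublinear functional below \<open>p\<close>.\<close>
  proof (rule predicate_Zorn[where P = "\<lambda>a b. b \<le> a"])
    show "partial_order_on ?A (relation_of (\<lambda>a b. b \<le> a) ?A)"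
      by (rule partial_order_on_relation_ofI) auto
    fix C assume C: "C \<in> Chains (relation_of (\<lambda>a b. b \<le> a) ?A)"
    then have CA: "\<And>q. q \<in> C \<Longrightarrow> sublinear q \<and> q \<le> p"
      using Chains_relation_of by blast
    have ch: "\<And>q r. q \<in> C \<Longrightarrow> r \<in> C \<Longrightarrow> q \<le> r \<or> r \<le> q"
      using C by (auto simp: Chains_def relation_of_def)
    show "\<exists>u\<in>?A. \<forall>a\<in>C. u \<le> a"
    proof (cases "C = {}")
      case True
      then show ?thesis using p by auto
    next
      case False
      note * = sublinear_INF_chain[OF p False CA ch]
      from False obtain q where "q \<in> C" by blast
      then have "(\<lambda>x. INF q\<in>C. q x) \<le> p"
        using *(2)[of q] CA[of q] order_trans by blast
      with * show ?thesis by blast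
    qed
  qed
  then obtain m where m: "sublinear m" "m \<le> p"
    and min: "\<And>q. sublinear q \<Longrightarrow> q \<le> p \<Longrightarrow> q \<le> m \<Longrightarrow> q = m"
    by blast
  have "m x + m y \<le> m (x + y)" for x y
  proof -
    note t = sublinear_tilt[OF m(1), where y = y]
    have "(\<lambda>x. INF t\<in>{0..}. m (x + t *\<^sub>R y) - t * m y) = m"
      using t(1,2) m(2) by (intro min) (auto intro: order_trans)
    from fun_cong[OF this, of x] t(3)[of x] show ?thesis by simp
  qed
  then have add: "m (x + y) = m x + m y" for x y
    using sublinear_add[OF m(1), of x y] by (simp add: antisym)
  have neg: "m (- x) = - m x" for x
    using add[of x "- x"] sublinear_zero[OF m(1)] by simp
  have "m (c *\<^sub>R x) = c * m x" for c x
    using sublinear_scaleR[OF m(1), of c x] sublinear_scaleR[OF m(1), of "- c" x] neg[of "c *\<^sub>R x"]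
    by (cases "0 \<le> c") auto
  with add have "linear m"
    by (intro linearI) auto
  with m(2) that show thesis by blast
qed

text \<open>Any linear \<open>g\<close> below the tilt of \<open>p\<close> in direction
  \<open>y\<close> satisfies \<open>g (- y) \<le> - p y\<close>, that is
  \<open>p y \<le> g y\<close>; the tilt lies below \<open>p\<close>, so equality holds at
  \<open>y\<close>.\<close>

lemma hahn_banach_sublinear:
  fixes p :: "'a::real_vector \<Rightarrow> real"
  assumes p: "sublinear p"
  obtains g where "linear g" "g \<le> p" "g y = p y"
proof -
  note t = sublinear_tilt[OF p, where y = y]
  obtain g where g: "linear g" "g \<le> (\<lambda>x. INF t\<in>{0..}. p (x + t *\<^sub>R y) - t * p y)"
    using linear_below_sublinear[OF t(1)] by blast
  have "g (- y) \<le> - p y"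
    using le_funD[OF g(2), of "- y"] t(3)[of "- y"] sublinear_zero[OF p] by simp
  then have "p y \<le> g y"
    using linear_neg[OF g(1), of y] by simp
  moreover have "g \<le> p"
    using g(2) t(2) by (rule order_trans)
  ultimately show thesis
    using that[OF g(1)] le_funD[of g p y] by (simp add: antisym)
qed

section \<open>Norming functionals and separation from a subspace\<close>

lemma blinfun_below_norm:
  fixes g :: "'a::real_normed_vector \<Rightarrow> real"
  assumes lin: "linear g" and le: "\<And>x. g x \<le> norm x"
  obtains \<psi> where "blinfun_apply \<psi> = g" "norm \<psi> \<le> 1"
proof -
  have abs: "norm (g x) \<le> norm x" for x
    using le[of x] le[of "- x"] linear_neg[OF lin, of x] by simp
  then have bl: "bounded_linear g"
    using lin by (intro bounded_linear_intro[where K = 1]) (auto simp: linear_add linear_scale)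
  then have "blinfun_apply (Blinfun g) = g"
    by (rule bounded_linear_Blinfun_apply)
  moreover from this abs have "norm (Blinfun g) \<le> 1"
    by (intro norm_blinfun_bound) auto
  ultimately show thesis by (rule that)
qed

lemma norming_functional:
  fixes x :: "'a::real_normed_vector"
  obtains \<psi> :: "'a \<Rightarrow>\<^sub>L real" where "norm \<psi> \<le> 1" "blinfun_apply \<psi> x = norm x"
proof -
  have "sublinear (norm :: 'a \<Rightarrow> real)"
    by (simp add: sublinear_def norm_triangle_ineq)
  then obtain g where g: "linear g" "g \<le> norm" "g x = norm x"
    by (rule hahn_banach_sublinear)
  obtain \<psi> :: "'a \<Rightarrow>\<^sub>L real" where "blinfun_apply \<psi> = g" "norm \<psi> \<le> 1"
    using blinfun_below_norm[OF g(1) le_funD[OF g(2)]] by blast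
  with g(3) that show thesis by simp
qed

text \<open>The distance to a subspace is the seminorm of the quotient. It serves as the dominating
  functional when a point is separated from the subspace.\<close>

lemma infdist_subspace_sublinear:
  assumes S: "subspace S"
  shows "sublinear (\<lambda>x::'a::real_normed_vector. infdist x S)"
proof -
  have ne: "S \<noteq> {}" using subspace_0[OF S] by blast
  have ge: "b \<le> infdist x S" if "\<And>a. a \<in> S \<Longrightarrow> b \<le> norm (x - a)" for b x
    unfolding infdist_notempty[OF ne] using that by (intro cINF_greatest[OF ne]) (simp add: dist_norm)
  have le: "infdist x S \<le> norm (x - a)" if "a \<in> S" for a x
    using infdist_le[OF that, of x] by (simp add: dist_norm)
  show ?thesis
  proof (rule sublinearI)
    fix x y
    have *: "infdist (x + y) S \<le> norm (x - a) + norm (y - b)" if "a \<in> S" "b \<in> S" for a b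
      using le[OF subspace_add[OF S that], of "x + y"] norm_triangle_ineq[of "x - a" "y - b"]
      by (simp add: algebra_simps)
    have "infdist (x + y) S - norm (y - b) \<le> infdist x S" if "b \<in> S" for b
      using *[OF _ that] by (intro ge) (simp add: algebra_simps)
    then have "infdist (x + y) S - infdist x S \<le> infdist y S"
      by (intro ge) (simp add: algebra_simps)
    then show "infdist (x + y) S \<le> infdist x S + infdist y S" by simp
  next
    fix c :: real and x
    assume c: "0 < c"
    have "infdist (c *\<^sub>R x) S / c \<le> infdist x S"
    proof (rule ge)
      fix a assume "a \<in> S"
      then have "infdist (c *\<^sub>R x) S \<le> norm (c *\<^sub>R x - c *\<^sub>R a)"
        using S by (intro le) (rule subspace_scale)
      also have "\<dots> = c * norm (x - a)"
        using c by (simp flip: scaleR_diff_right)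
      finally show "infdist (c *\<^sub>R x) S / c \<le> norm (x - a)"
        using c by (simp add: field_simps)
    qed
    then show "infdist (c *\<^sub>R x) S \<le> c * infdist x S"
      using c by (simp add: field_simps)
  next
    show "infdist 0 S = 0"
      using subspace_0[OF S] by simp
  qed
qed

text \<open>A linear \<open>g\<close> below the distance to \<open>S\<close> vanishes on
  \<open>S\<close>, as \<open>S\<close> is symmetric and the distance is 0 there. Choosing
  \<open>g\<close> equal to the distance at \<open>y\<close> makes it nonzero at \<open>y\<close>.
  The distance is at most the norm, so \<open>g\<close> is continuous.\<close>

lemma separate_from_subspace:
  fixes y :: "'a::real_normed_vector"
  assumes S: "subspace S" and y: "y \<notin> closure S"
  obtains \<psi> :: "'a \<Rightarrow>\<^sub>L real" where "\<And>x. x \<in> S \<Longrightarrow> blinfun_apply \<psi> x = 0" "blinfun_apply \<psi> y \<noteq> 0"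
proof -
  have ne: "S \<noteq> {}" using subspace_0[OF S] by blast
  obtain g where g: "linear g" "g \<le> (\<lambda>x. infdist x S)" "g y = infdist y S"
    using infdist_subspace_sublinear[OF S] by (rule hahn_banach_sublinear)
  have "g x \<le> norm x" for x
    using le_funD[OF g(2), of x] infdist_le[OF subspace_0[OF S], of x] by (simp add: dist_norm)
  then obtain \<psi> :: "'a \<Rightarrow>\<^sub>L real" where \<psi>: "blinfun_apply \<psi> = g"
    using blinfun_below_norm[OF g(1)] by blast
  have "g x = 0" if "x \<in> S" for x
    using le_funD[OF g(2), of x] le_funD[OF g(2), of "- x"] that subspace_neg[OF S that]
      linear_neg[OF g(1), of x] by simp
  moreover have "g y \<noteq> 0"
    using y g(3) in_closure_iff_infdist_zero[OF ne, of y] by simp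
  ultimately show thesis
    using that[of \<psi>] \<psi> by simp
qed

lemma norm_le_if_functionals_le:
  fixes x :: "'a::real_normed_vector"
  assumes "\<And>\<psi> :: 'a \<Rightarrow>\<^sub>L real. blinfun_apply \<psi> x \<le> C * norm \<psi>" and "0 \<le> C"
  shows "norm x \<le> C"
proof -
  obtain \<psi> :: "'a \<Rightarrow>\<^sub>L real" where "norm \<psi> \<le> 1" "blinfun_apply \<psi> x = norm x"
    by (rule norming_functional)
  with assms(1)[of \<psi>] mult_left_mono[of "norm \<psi>" 1 C] \<open>0 \<le> C\<close> show ?thesis by simp
qed

lemma functionals_separate_points:
  fixes x y :: "'a::real_normed_vector"
  assumes "\<And>\<psi> :: 'a \<Rightarrow>\<^sub>L real. blinfun_apply \<psi> x = blinfun_apply \<psi> y"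
  shows "x = y"
proof -
  obtain \<psi> :: "'a \<Rightarrow>\<^sub>L real" where "blinfun_apply \<psi> (x - y) = norm (x - y)"
    by (rule norming_functional)
  with assms[of \<psi>] show ?thesis by (simp add: blinfun.diff_right)
qed

section \<open>Weak convergence\<close>

lemma limitin_weak_topology_iff:
  fixes u :: "'b \<Rightarrow> 'a::real_normed_vector"
  shows "limitin weak_topology u l F \<longleftrightarrow>
    (\<forall>\<psi> :: 'a \<Rightarrow>\<^sub>L real. ((\<lambda>t. blinfun_apply \<psi> (u t)) \<longlongrightarrow> blinfun_apply \<psi> l) F)"
    (is "?L = ?R")
proof
  assume L: ?L
  show ?R
  proof (intro allI topological_tendstoI)
    fix \<psi> :: "'a \<Rightarrow>\<^sub>L real" and U :: "real set"
    assume "open U" "blinfun_apply \<psi> l \<in> U"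
    moreover from \<open>open U\<close> have "openin weak_topology (blinfun_apply \<psi> -` U)"
      unfolding weak_topology_def openin_topology_generated_by_iff
      by (intro generate_topology_on.Basis) blast
    ultimately show "eventually (\<lambda>t. blinfun_apply \<psi> (u t) \<in> U) F"
      using limitinD[OF L, of "blinfun_apply \<psi> -` U"] by simp
  qed
next
  assume R: ?R
  let ?B = "{blinfun_apply \<psi> -` U | (\<psi> :: 'a \<Rightarrow>\<^sub>L real) U. open U}"
  \<comment> \<open>The whole space belongs to the subbase, which identifies the carrier of the
    generated topology.\<close>
  have "UNIV = blinfun_apply (0 :: 'a \<Rightarrow>\<^sub>L real) -` UNIV" by simp
  then have "UNIV \<in> ?B" by blast
  then have top: "topspace (weak_topology :: 'a topology) = UNIV"
    unfolding weak_topology_def topology_generated_by_topspace by blast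
  have "eventually (\<lambda>t. u t \<in> W) F" if "generate_topology_on ?B W" "l \<in> W" for W
    using that
  proof (induction rule: generate_topology_on.induct)
    case (Int a b)
    then show ?case by (auto simp: eventually_conj_iff)
  next
    case (UN K)
    then obtain k where k: "k \<in> K" "l \<in> k" by blast
    with UN have "eventually (\<lambda>t. u t \<in> k) F" by blast
    then show ?case by eventually_elim (use k in blast)
  next
    case (Basis s)
    then obtain \<psi> :: "'a \<Rightarrow>\<^sub>L real" and U where "s = blinfun_apply \<psi> -` U" "open U" by blast
    with Basis.prems R show ?case
      using topological_tendstoD[of "\<lambda>t. blinfun_apply \<psi> (u t)" "blinfun_apply \<psi> l" F U] by auto
  qed simp
  then show ?L
    unfolding limitin_def top
    by (auto simp: weak_topology_def openin_topology_generated_by_iff)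
qed

lemma limitin_weak_topology_bounded_linear:
  fixes i :: "'a::real_normed_vector \<Rightarrow> 'b::real_normed_vector"
  assumes i: "bounded_linear i" and u: "limitin weak_topology u l F"
  shows "limitin weak_topology (i \<circ> u) (i l) F"
  unfolding limitin_weak_topology_iff
proof
  fix \<phi> :: "'b \<Rightarrow>\<^sub>L real"
  have "((\<lambda>t. blinfun_apply (\<phi> o\<^sub>L Blinfun i) (u t)) \<longlongrightarrow> blinfun_apply (\<phi> o\<^sub>L Blinfun i) l) F"
    using u unfolding limitin_weak_topology_iff by blast
  then show "((\<lambda>t. blinfun_apply \<phi> ((i \<circ> u) t)) \<longlongrightarrow> blinfun_apply \<phi> (i l)) F"
    by (simp add: bounded_linear_Blinfun_apply[OF i])
qed

section \<open>Reflexivity and the lifting of weak limits\<close>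

lemma bidual_embedding_apply: "blinfun_apply (bidual_embedding x) \<psi> = blinfun_apply \<psi> x"
  unfolding bidual_embedding_def
  by (subst bounded_linear_Blinfun_apply) (auto intro: blinfun.bounded_linear_left)

lemma reflexive_spaceE:
  fixes \<Phi> :: "('a::real_normed_vector \<Rightarrow>\<^sub>L real) \<Rightarrow>\<^sub>L real"
  assumes "reflexive_space TYPE('a)"
  obtains x where "\<And>\<psi>. blinfun_apply \<Phi> \<psi> = blinfun_apply \<psi> x"
proof -
  obtain x where "\<Phi> = bidual_embedding x"
    using assms unfolding reflexive_space_def by (metis surjD)
  then show thesis
    using that[of x] by (simp add: bidual_embedding_apply)
qed

text \<open>Otherwise some nonzero functional on the dual vanishes on the range of the adjoint. By
  reflexivity it is evaluation at a point \<open>x\<close>; then every functional on the target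
  kills \<open>I x\<close>, so \<open>I x = 0\<close>, and injectivity forces
  \<open>x = 0\<close>.\<close>

lemma dense_range_adjoint:
  fixes I :: "'a::real_normed_vector \<Rightarrow>\<^sub>L 'b::real_normed_vector"
  assumes refl: "reflexive_space TYPE('a)" and inj: "inj (blinfun_apply I)"
  shows "closure (range (\<lambda>\<phi> :: 'b \<Rightarrow>\<^sub>L real. \<phi> o\<^sub>L I)) = UNIV"
proof (rule ccontr)
  let ?S = "range (\<lambda>\<phi> :: 'b \<Rightarrow>\<^sub>L real. \<phi> o\<^sub>L I)"
  assume "closure ?S \<noteq> UNIV"
  then obtain \<psi> where \<psi>: "\<psi> \<notin> closure ?S" by blast
  have "linear (\<lambda>\<phi> :: 'b \<Rightarrow>\<^sub>L real. \<phi> o\<^sub>L I)"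
    by (intro bounded_linear.linear bounded_bilinear.bounded_linear_left
        bounded_bilinear_blinfun_compose)
  then have "subspace ?S"
    by (rule linear_subspace_image) (rule subspace_UNIV)
  from this \<psi> obtain \<Phi> :: "('a \<Rightarrow>\<^sub>L real) \<Rightarrow>\<^sub>L real"
    where "\<And>\<xi>. \<xi> \<in> ?S \<Longrightarrow> blinfun_apply \<Phi> \<xi> = 0" and \<Phi>\<psi>: "blinfun_apply \<Phi> \<psi> \<noteq> 0"
    by (rule separate_from_subspace) (rule that, simp_all)
  then have \<Phi>: "blinfun_apply \<Phi> (\<phi> o\<^sub>L I) = 0" for \<phi> :: "'b \<Rightarrow>\<^sub>L real"
    by blast
  obtain x where x: "\<And>\<psi>. blinfun_apply \<Phi> \<psi> = blinfun_apply \<psi> x"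
    using reflexive_spaceE[OF refl] by blast
  have "blinfun_apply I x = 0"
  proof (rule functionals_separate_points)
    fix \<phi> :: "'b \<Rightarrow>\<^sub>L real"
    show "blinfun_apply \<phi> (blinfun_apply I x) = blinfun_apply \<phi> 0"
      using \<Phi>[of \<phi>] x[of "\<phi> o\<^sub>L I"] by (simp add: blinfun.zero_right)
  qed
  then have "blinfun_apply I x = blinfun_apply I 0"
    by (simp add: blinfun.zero_right)
  with inj have "x = 0" by (rule injD)
  with x[of \<psi>] \<Phi>\<psi> show False by simp
qed

text \<open>The core of the argument. Functionals of the form \<open>\<phi> o\<^sub>L I\<close> have
  limits along \<open>g\<close> by assumption; boundedness of \<open>g\<close> and density of these
  functionals extend this to the whole dual. The limits form a bounded functional on the dual, which
  reflexivity represents by the point \<open>e\<close>. An arbitrary nontrivial filter is allowed,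
  since the lemma is applied both to one-sided limits and to limits along a restricted set of
  times.\<close>

lemma weak_limit_lift:
  fixes i :: "'a::real_normed_vector \<Rightarrow> 'b::real_normed_vector"
  assumes refl: "reflexive_space TYPE('a)" and i: "bounded_linear i" "inj i"
    and F: "F \<noteq> bot" and bd: "eventually (\<lambda>t. norm (g t) \<le> C) F"
    and lim: "limitin weak_topology (i \<circ> g) l F"
  obtains e where "i e = l" "norm e \<le> C" "limitin weak_topology g e F"
proof -
  define I where "I = Blinfun i"
  have I: "blinfun_apply I = i"
    unfolding I_def using i(1) by (rule bounded_linear_Blinfun_apply)
  from bd F obtain t where "norm (g t) \<le> C"
    using eventually_happens' by blast
  then have C: "0 \<le> C" using norm_ge_zero order_trans by blast
  have bound: "eventually (\<lambda>t. norm (blinfun_apply \<psi> (g t)) \<le> C * norm \<psi>) F" for \<psi> :: "'a \<Rightarrow>\<^sub>L real"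
    using bd
  proof eventually_elim
    case (elim t)
    have "norm (blinfun_apply \<psi> (g t)) \<le> norm \<psi> * norm (g t)"
      by (rule norm_blinfun)
    also have "\<dots> \<le> C * norm \<psi>"
      using mult_left_mono[OF elim norm_ge_zero[of \<psi>]] by (simp add: mult.commute)
    finally show ?case .
  qed
  have lim': "((\<lambda>t. blinfun_apply (\<phi> o\<^sub>L I) (g t)) \<longlongrightarrow> blinfun_apply \<phi> l) F" for \<phi> :: "'b \<Rightarrow>\<^sub>L real"
    using lim unfolding limitin_weak_topology_iff by (simp add: I)
  have bound_l: "norm (blinfun_apply \<phi> l) \<le> C * norm (\<phi> o\<^sub>L I)" for \<phi> :: "'b \<Rightarrow>\<^sub>L real"
    by (rule tendsto_upperbound[OF tendsto_norm[OF lim'] bound F])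
  have "\<forall>\<psi> :: 'a \<Rightarrow>\<^sub>L real. \<exists>L. ((\<lambda>t. blinfun_apply \<psi> (g t)) \<longlongrightarrow> L) F"
  proof
    fix \<psi> :: "'a \<Rightarrow>\<^sub>L real"
    have "\<psi> \<in> closure (range (\<lambda>\<phi> :: 'b \<Rightarrow>\<^sub>L real. \<phi> o\<^sub>L I))"
      using dense_range_adjoint[OF refl, of I] i(2) I by simp
    then obtain s where "\<forall>n. s n \<in> range (\<lambda>\<phi> :: 'b \<Rightarrow>\<^sub>L real. \<phi> o\<^sub>L I)" and s: "s \<longlonglongrightarrow> \<psi>"
      unfolding closure_sequential by blast
    then have "\<forall>n. \<exists>\<phi> :: 'b \<Rightarrow>\<^sub>L real. s n = \<phi> o\<^sub>L I"
      by (simp add: image_iff)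
    from choice[OF this] obtain \<phi> :: "nat \<Rightarrow> 'b \<Rightarrow>\<^sub>L real" where \<phi>: "\<And>n. s n = \<phi> n o\<^sub>L I"
      by blast
    have diff: "(\<phi> m o\<^sub>L I) - (\<phi> n o\<^sub>L I) = (\<phi> m - \<phi> n) o\<^sub>L I" for m n
      by (rule blinfun_eqI) (simp add: blinfun.diff_left)
    \<comment> \<open>The \<open>\<phi> n\<close> themselves may fail to converge; only their
      compositions \<open>s n\<close> do. Applied to differences, \<open>bound_l\<close> controls
      the values at \<open>l\<close> by these compositions alone.\<close>
    have "Cauchy (\<lambda>n. blinfun_apply (\<phi> n) l)"
    proof (rule metric_CauchyI)
      fix \<epsilon> :: real assume \<epsilon>: "0 < \<epsilon>"
      have "Cauchy s" using s by (rule LIMSEQ_imp_Cauchy)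
      \<comment> \<open>The denominator is \<open>C + 1\<close> because \<open>C\<close> may be
        0.\<close>
      then obtain N where N: "\<And>m n. m \<ge> N \<Longrightarrow> n \<ge> N \<Longrightarrow> dist (s m) (s n) < \<epsilon> / (C + 1)"
        using metric_CauchyD[of s "\<epsilon> / (C + 1)"] \<epsilon> C by auto
      have "dist (blinfun_apply (\<phi> m) l) (blinfun_apply (\<phi> n) l) < \<epsilon>" if "m \<ge> N" "n \<ge> N" for m n
      proof -
        have "dist (blinfun_apply (\<phi> m) l) (blinfun_apply (\<phi> n) l) \<le> C * dist (s m) (s n)"
          using bound_l[of "\<phi> m - \<phi> n"] by (simp add: dist_norm blinfun.diff_left \<phi> diff)
        also have "\<dots> \<le> (C + 1) * dist (s m) (s n)"
          by (intro mult_right_mono) auto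
        also have "\<dots> < \<epsilon>"
          using N[OF that] C by (simp add: field_simps)
        finally show ?thesis .
      qed
      then show "\<exists>N. \<forall>m\<ge>N. \<forall>n\<ge>N. dist (blinfun_apply (\<phi> m) l) (blinfun_apply (\<phi> n) l) < \<epsilon>"
        by blast
    qed
    then obtain L where L: "(\<lambda>n. blinfun_apply (\<phi> n) l) \<longlonglongrightarrow> L"
      using Cauchy_convergent convergent_def by blast
    \<comment> \<open>Three errors: replacing \<open>\<psi>\<close> by \<open>s n\<close> costs at
      most \<open>C * norm (\<psi> - s n)\<close>, eventually in \<open>t\<close>; for fixed
      \<open>n\<close> the values of \<open>s n\<close> along \<open>g\<close> tend to
      \<open>\<phi> n\<close> at \<open>l\<close>; these in turn tend to \<open>L\<close>.\<close>
    have "((\<lambda>t. blinfun_apply \<psi> (g t)) \<longlongrightarrow> L) F"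
    proof (rule tendstoI)
      fix \<epsilon> :: real assume \<epsilon>: "0 < \<epsilon>"
      have "(\<lambda>n. C * norm (\<psi> - s n)) \<longlonglongrightarrow> C * norm (\<psi> - \<psi>)"
        by (intro tendsto_intros s)
      then have "eventually (\<lambda>n. C * norm (\<psi> - s n) < \<epsilon> / 3) sequentially"
        using \<epsilon> by (intro order_tendstoD(2)[of _ "C * norm (\<psi> - \<psi>)"]) auto
      moreover have "eventually (\<lambda>n. dist (blinfun_apply (\<phi> n) l) L < \<epsilon> / 3) sequentially"
        using L \<epsilon> by (intro tendstoD) auto
      ultimately have "eventually (\<lambda>n. C * norm (\<psi> - s n) < \<epsilon> / 3 \<and>
          dist (blinfun_apply (\<phi> n) l) L < \<epsilon> / 3) sequentially"
        by eventually_elim blast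
      then obtain n where n: "C * norm (\<psi> - s n) < \<epsilon> / 3" "dist (blinfun_apply (\<phi> n) l) L < \<epsilon> / 3"
        using eventually_happens' sequentially_bot by blast
      have "eventually (\<lambda>t. dist (blinfun_apply (s n) (g t)) (blinfun_apply (\<phi> n) l) < \<epsilon> / 3) F"
        unfolding \<phi> using \<epsilon> by (intro tendstoD[OF lim']) simp
      with bound[of "\<psi> - s n"]
      show "eventually (\<lambda>t. dist (blinfun_apply \<psi> (g t)) L < \<epsilon>) F"
      proof eventually_elim
        case (elim t)
        have "dist (blinfun_apply \<psi> (g t)) (blinfun_apply (s n) (g t)) < \<epsilon> / 3"
          using elim(1) n(1) by (simp add: dist_norm blinfun.diff_left)
        then show ?case
          using elim(2) n(2) unfolding dist_real_def by linarith
      qed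
    qed
    then show "\<exists>L. ((\<lambda>t. blinfun_apply \<psi> (g t)) \<longlongrightarrow> L) F" by blast
  qed
  from choice[OF this] obtain L :: "('a \<Rightarrow>\<^sub>L real) \<Rightarrow> real" where L: "\<And>\<psi>. ((\<lambda>t. blinfun_apply \<psi> (g t)) \<longlongrightarrow> L \<psi>) F"
    by blast
  have L_bound: "norm (L \<psi>) \<le> C * norm \<psi>" for \<psi>
    by (rule tendsto_upperbound[OF tendsto_norm[OF L] bound F])
  \<comment> \<open>\<open>L\<close> is linear because limits along a nontrivial filter are unique,
    and it inherits the bound \<open>C\<close>.\<close>
  have "bounded_linear L"
  proof (rule bounded_linear_intro[where K = C])
    fix \<psi> \<xi> :: "'a \<Rightarrow>\<^sub>L real" and c :: real
    show "L (\<psi> + \<xi>) = L \<psi> + L \<xi>"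
      using tendsto_unique[OF F L[of "\<psi> + \<xi>"]] tendsto_add[OF L[of \<psi>] L[of \<xi>]]
      by (simp add: blinfun.add_left)
    show "L (c *\<^sub>R \<psi>) = c *\<^sub>R L \<psi>"
      using tendsto_unique[OF F L[of "c *\<^sub>R \<psi>"]] tendsto_scaleR[OF tendsto_const L[of \<psi>], of c]
      by (simp add: blinfun.scaleR_left)
    show "norm (L \<psi>) \<le> norm \<psi> * C"
      using L_bound[of \<psi>] by (simp add: mult.commute)
  qed
  then have "blinfun_apply (Blinfun L) = L"
    by (rule bounded_linear_Blinfun_apply)
  then obtain e where e: "\<And>\<psi>. L \<psi> = blinfun_apply \<psi> e"
    using reflexive_spaceE[OF refl, of "Blinfun L"] by metis
  show thesis
  proof
    show "i e = l"
    proof (rule functionals_separate_points)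
      fix \<phi> :: "'b \<Rightarrow>\<^sub>L real"
      show "blinfun_apply \<phi> (i e) = blinfun_apply \<phi> l"
        using tendsto_unique[OF F lim'[of \<phi>] L[of "\<phi> o\<^sub>L I"]] e[of "\<phi> o\<^sub>L I"] by (simp add: I)
    qed
    show "norm e \<le> C"
    proof (rule norm_le_if_functionals_le[OF _ C])
      fix \<psi> :: "'a \<Rightarrow>\<^sub>L real"
      show "blinfun_apply \<psi> e \<le> C * norm \<psi>"
        using L_bound[of \<psi>] e[of \<psi>] by simp
    qed
    show "limitin weak_topology g e F"
      unfolding limitin_weak_topology_iff using L e by simp
  qed
qed

text \<open>Uniform boundedness by Baire's theorem in the dual, which is complete even if the space
  itself is not: the closed sets \<open>G n\<close> cover the dual, so one of them contains a
  ball.\<close>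

lemma weakly_bounded_imp_bounded:
  fixes A :: "'a::real_normed_vector set"
  assumes bd: "\<And>\<psi> :: 'a \<Rightarrow>\<^sub>L real. bounded (blinfun_apply \<psi> ` A)"
  shows "bounded A"
proof -
  define G where "G n = {\<psi> :: 'a \<Rightarrow>\<^sub>L real. \<forall>x\<in>A. \<bar>blinfun_apply \<psi> x\<bar> \<le> real n}" for n
  have "closed (G n)" for n
  proof -
    have "G n = (\<Inter>x\<in>A. {\<psi>. \<bar>blinfun_apply \<psi> x\<bar> \<le> real n})"
      by (auto simp: G_def)
    then show ?thesis
      by (auto intro!: closed_INT closed_Collect_le continuous_intros)
  qed
  moreover have "interior (\<Union>(range G)) \<noteq> {}"
  proof -
    have "\<psi> \<in> \<Union>(range G)" for \<psi>
    proof -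
      obtain B where B: "\<And>x. x \<in> A \<Longrightarrow> \<bar>blinfun_apply \<psi> x\<bar> \<le> B"
        using bd[of \<psi>] unfolding bounded_iff by auto
      obtain n where "B \<le> real n"
        using real_arch_simple by blast
      with B have "\<psi> \<in> G n"
        unfolding G_def by (blast intro: order_trans)
      then show ?thesis by blast
    qed
    then have "\<Union>(range G) = UNIV" by blast
    then show ?thesis by simp
  qed
  ultimately obtain n where "interior (G n) \<noteq> {}"
    using Baire_category_alt[of "euclidean :: ('a \<Rightarrow>\<^sub>L real) topology" "range G"]
      completely_metrizable_space_euclidean by auto
  then obtain \<psi> r where r: "0 < r" "cball \<psi> r \<subseteq> G n"
    by (metis all_not_in_conv mem_interior_cball)
  have "norm x \<le> 2 * real n / r" if x: "x \<in> A" for x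
  proof -
    obtain \<xi> :: "'a \<Rightarrow>\<^sub>L real" where \<xi>: "norm \<xi> \<le> 1" "blinfun_apply \<xi> x = norm x"
      by (rule norming_functional)
    \<comment> \<open>Both the centre and this point of the ball lie in \<open>G n\<close>; their
      difference is \<open>r\<close> times a functional norming \<open>x\<close>, which bounds
      \<open>r * norm x\<close> by \<open>2 * real n\<close>.\<close>
    have "\<psi> + r *\<^sub>R \<xi> \<in> cball \<psi> r"
      using \<xi>(1) r(1) mult_left_mono[OF \<xi>(1), of r] by (simp add: dist_norm)
    with r have "\<psi> + r *\<^sub>R \<xi> \<in> G n" "\<psi> \<in> G n"
      by auto
    then have "\<bar>blinfun_apply \<psi> x + r * norm x\<bar> \<le> real n" "\<bar>blinfun_apply \<psi> x\<bar> \<le> real n"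
      using x \<xi>(2) by (auto simp: G_def blinfun.add_left blinfun.scaleR_left)
    then have "r * norm x \<le> 2 * real n" by linarith
    then show ?thesis using r(1) by (simp add: field_simps)
  qed
  then show ?thesis unfolding bounded_iff by blast
qed

section \<open>Boundedness and measurability of weakly cadlag functions\<close>

lemma Dw_right: "u \<in> Dw T \<Longrightarrow> 0 \<le> t \<Longrightarrow> t < T \<Longrightarrow> limitin weak_topology u (u t) (at_right t)"
  by (auto simp: Dw_def)

lemma Dw_left:
  assumes "u \<in> Dw T" "0 < t" "t \<le> T"
  obtains l where "limitin weak_topology u l (at_left t)"
  using assms by (fastforce simp: Dw_def)

lemma tendsto_imp_eventually_norm_le:
  fixes f :: "'a \<Rightarrow> 'b::real_normed_vector"
  assumes "(f \<longlongrightarrow> l) F"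
  shows "eventually (\<lambda>x. norm (f x) \<le> norm l + 1) F"
proof -
  have "eventually (\<lambda>x. norm (f x) < norm l + 1) F"
    using tendsto_norm[OF assms] by (rule order_tendstoD) simp
  then show ?thesis by eventually_elim simp
qed

text \<open>The one-sided limits give a bound near each point of the compact interval, and bisection
  makes it global.\<close>

lemma Dw_bounded_functional:
  fixes u :: "real \<Rightarrow> 'a::real_normed_vector" and \<psi> :: "'a \<Rightarrow>\<^sub>L real"
  assumes u: "u \<in> Dw T"
  shows "bounded ((\<lambda>t. blinfun_apply \<psi> (u t)) ` {0..T})"
proof (cases "0 \<le> T")
  case True
  let ?f = "\<lambda>t. blinfun_apply \<psi> (u t)"
  \<comment> \<open>The intersection looks redundant here, but the local step of the bisection
    concerns intervals around \<open>x\<close> that may leave \<open>{0..T}\<close>.\<close>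
  have "bounded (?f ` ({0..T} \<inter> {0..T}))"
    using True
  proof (induction rule: Bolzano[where P = "\<lambda>a b. bounded (?f ` ({a..b} \<inter> {0..T}))"])
    case (trans a b c)
    have "{a..c} \<inter> {0..T} = ({a..b} \<inter> {0..T}) \<union> ({b..c} \<inter> {0..T})"
      using trans(3,4) by auto
    with trans(1,2) show ?case by (simp add: image_Un)
  next
    case (local x)
    \<comment> \<open>For \<open>x = T\<close> no \<open>s\<close> satisfies the condition, so the
      missing right-hand limit does no harm; the value at \<open>x\<close> itself enters the bound
      separately.\<close>
    have "\<exists>B d. 0 < d \<and> (\<forall>s. x < s \<and> s < x + d \<and> s \<le> T \<longrightarrow> \<bar>?f s\<bar> \<le> B)"
    proof (cases "x < T")
      case True
      then have "(?f \<longlongrightarrow> ?f x) (at_right x)"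
        using Dw_right[OF u local(1)] by (simp add: limitin_weak_topology_iff)
      from tendsto_imp_eventually_norm_le[OF this] obtain b where
        "x < b" "\<And>s. x < s \<Longrightarrow> s < b \<Longrightarrow> \<bar>?f s\<bar> \<le> \<bar>?f x\<bar> + 1"
        by (auto simp: eventually_at_right_field)
      then show ?thesis
        by (intro exI[of _ "\<bar>?f x\<bar> + 1"] exI[of _ "b - x"]) auto
    qed (auto intro!: exI[of _ 1])
    then obtain B d where r: "0 < d" "\<And>s. x < s \<Longrightarrow> s < x + d \<Longrightarrow> s \<le> T \<Longrightarrow> \<bar>?f s\<bar> \<le> B"
      by blast
    have "\<exists>B d. 0 < d \<and> (\<forall>s. x - d < s \<and> s < x \<and> 0 \<le> s \<longrightarrow> \<bar>?f s\<bar> \<le> B)"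
    proof (cases "0 < x")
      case True
      then obtain l where "limitin weak_topology u l (at_left x)"
        using Dw_left[OF u _ local(2)] by blast
      then have "(?f \<longlongrightarrow> blinfun_apply \<psi> l) (at_left x)"
        by (simp add: limitin_weak_topology_iff)
      from tendsto_imp_eventually_norm_le[OF this] obtain b where
        "b < x" "\<And>s. b < s \<Longrightarrow> s < x \<Longrightarrow> \<bar>?f s\<bar> \<le> \<bar>blinfun_apply \<psi> l\<bar> + 1"
        by (auto simp: eventually_at_left_field)
      then show ?thesis
        by (intro exI[of _ "\<bar>blinfun_apply \<psi> l\<bar> + 1"] exI[of _ "x - b"]) auto
    qed (auto intro!: exI[of _ 1])
    then obtain B' d' where l: "0 < d'" "\<And>s. x - d' < s \<Longrightarrow> s < x \<Longrightarrow> 0 \<le> s \<Longrightarrow> \<bar>?f s\<bar> \<le> B'"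
      by blast
    show ?case
    proof (intro exI[of _ "min d d'"] conjI allI impI)
      fix a b assume ab: "a \<le> x \<and> x \<le> b \<and> b - a < min d d'"
      have "\<bar>?f s\<bar> \<le> max \<bar>?f x\<bar> (max B B')" if "s \<in> {a..b} \<inter> {0..T}" for s
        using that ab r(2)[of s] l(2)[of s] by (cases s x rule: linorder_cases) auto
      then show "bounded (?f ` ({a..b} \<inter> {0..T}))"
        unfolding bounded_iff by (intro exI[of _ "max \<bar>?f x\<bar> (max B B')"]) auto
    qed (use r(1) l(1) in simp)
  qed
  then show ?thesis by simp
qed simp

lemma Dw_bounded: "u \<in> Dw T \<Longrightarrow> bounded (u ` {0..T})"
  by (rule weakly_bounded_imp_bounded) (use Dw_bounded_functional in \<open>simp add: image_image\<close>)

text \<open>The points of \<open>U\<close> outside the union of the intervals \<open>{t<..<b t}\<close> are separated by rationals.\<close>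

lemma right_open_borel:
  fixes U :: "real set"
  assumes U: "\<And>t. t \<in> U \<Longrightarrow> eventually (\<lambda>s. s \<in> U) (at_right t)"
  shows "U \<in> sets borel"
proof -
  have "\<exists>b>t. {t<..<b} \<subseteq> U" if "t \<in> U" for t
    using U[OF that] by (auto simp: eventually_at_right_field subset_iff)
  then obtain b where b: "\<And>t. t \<in> U \<Longrightarrow> t < b t" "\<And>t. t \<in> U \<Longrightarrow> {t<..<b t} \<subseteq> U"
    by metis
  define V where "V = (\<Union>t\<in>U. {t<..<b t})"
  have "\<exists>q::rat. t < of_rat q \<and> of_rat q < b t" if "t \<in> U" for t
    using of_rat_dense[OF b(1)[OF that]] by blast
  then obtain q :: "real \<Rightarrow> rat" where q: "\<And>t. t \<in> U \<Longrightarrow> t < of_rat (q t) \<and> of_rat (q t) < b t"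
    by metis
  \<comment> \<open>As \<open>t\<close> avoids the interval attached to \<open>s\<close>, it lies at
    or beyond \<open>b s\<close>; hence \<open>q s\<close> is below \<open>b s\<close>, which is at
    most \<open>t\<close>, which is below \<open>q t\<close>.\<close>
  have less: "q s < q t" if "s \<in> U - V" "t \<in> U - V" "s < t" for s t
  proof -
    have "b s \<le> t" using that by (force simp: V_def)
    with q[of s] q[of t] that have "real_of_rat (q s) < real_of_rat (q t)" by force
    then show ?thesis by (simp add: of_rat_less)
  qed
  have "inj_on q (U - V)"
    by (rule inj_onI) (metis less less_irrefl linorder_less_linear)
  then have "countable (U - V)"
    by (rule countableI')
  then have "U - V \<in> sets borel"
    by (rule sets.countable[rotated]) simp
  moreover have "V \<in> sets borel"
    unfolding V_def by (intro borel_open open_UN) auto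
  ultimately have "V \<union> (U - V) \<in> sets borel"
    by (rule sets.Un[rotated])
  moreover have "V \<union> (U - V) = U"
    using b(2) by (auto simp: V_def)
  ultimately show ?thesis by simp
qed

text \<open>If the norm exceeds \<open>a\<close> at time \<open>t\<close>, then so does a functional
  norming \<open>u t - x\<close>. By weak right-continuity it still exceeds \<open>a\<close> just
  after \<open>t\<close>, where it remains a lower bound for the norm. Thus strict superlevel sets
  are open from the right, hence Borel.\<close>

lemma Dw_norm_measurable:
  fixes u :: "real \<Rightarrow> 'a::real_normed_vector"
  assumes u: "u \<in> Dw T"
  shows "(\<lambda>t. norm (u t - x)) \<in> borel_measurable (lebesgue_on {0<..<T})"
  unfolding borel_measurable_iff_greater
proof
  fix a
  let ?U = "{t \<in> {0<..<T}. a < norm (u t - x)}"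
  have "?U \<in> sets borel"
  proof (rule right_open_borel)
    fix t assume t: "t \<in> ?U"
    obtain \<psi> :: "'a \<Rightarrow>\<^sub>L real" where \<psi>: "norm \<psi> \<le> 1" "blinfun_apply \<psi> (u t - x) = norm (u t - x)"
      by (rule norming_functional)
    have "((\<lambda>s. blinfun_apply \<psi> (u s)) \<longlongrightarrow> blinfun_apply \<psi> (u t)) (at_right t)"
      using Dw_right[OF u, of t] t by (auto simp: limitin_weak_topology_iff)
    then have "((\<lambda>s. blinfun_apply \<psi> (u s) - blinfun_apply \<psi> x) \<longlongrightarrow>
        blinfun_apply \<psi> (u t) - blinfun_apply \<psi> x) (at_right t)"
      by (rule tendsto_diff) (rule tendsto_const)
    then have "eventually (\<lambda>s. a < blinfun_apply \<psi> (u s) - blinfun_apply \<psi> x) (at_right t)"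
      using t \<psi>(2) by (intro order_tendstoD) (auto simp: blinfun.diff_right)
    moreover have "eventually (\<lambda>s. s \<in> {t<..<T}) (at_right t)"
      using t by (intro eventually_at_right_real) simp
    ultimately show "eventually (\<lambda>s. s \<in> ?U) (at_right t)"
    proof eventually_elim
      case (elim s)
      have "blinfun_apply \<psi> (u s - x) \<le> 1 * norm (u s - x)"
        using norm_blinfun[of \<psi> "u s - x"] mult_right_mono[OF \<psi>(1), of "norm (u s - x)"] by simp
      with elim t show ?case by (auto simp: blinfun.diff_right)
    qed
  qed
  then have "?U \<in> sets (lebesgue_on {0<..<T})"
    by (subst sets_restrict_space_iff) auto
  then show "{t \<in> space (lebesgue_on {0<..<T}). a < norm (u t - x)} \<in> sets (lebesgue_on {0<..<T})"
    by (simp add: space_restrict_space)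
qed

section \<open>Separable range and approximation by simple functions\<close>

text \<open>Rational combinations are coded by lists of pairs of a rational and an index, a
  countable type. Their closure is a subspace containing \<open>A\<close>.\<close>

lemma countable_dense_in_span:
  fixes A :: "'a::real_normed_vector set"
  assumes "countable A"
  obtains d :: "nat \<Rightarrow> 'a" where "span A \<subseteq> closure (range d)"
proof -
  \<comment> \<open>Inserting 0 makes the set nonempty, so that the enumeration has exactly this
    range.\<close>
  define a where "a = from_nat_into (insert 0 A)"
  have a: "range a = insert 0 A"
    unfolding a_def using assms by (simp add: range_from_nat_into)
  define comb where "comb l = (\<Sum>(q, n)\<leftarrow>l. real_of_rat q *\<^sub>R a n)" for l :: "(rat \<times> nat) list"
  have comb_add: "comb (k @ l) = comb k + comb l" for k l
    by (simp add: comb_def)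
  have comb_scale: "real_of_rat c *\<^sub>R comb l = comb (map (\<lambda>(q, n). (c * q, n)) l)" for c l
    by (induction l) (auto simp: comb_def scaleR_add_right of_rat_mult)
  let ?D = "range comb"
  have "subspace (closure ?D)"
  proof (rule subspaceI)
    have "comb [] = 0" by (simp add: comb_def)
    then show "0 \<in> closure ?D"
      using closure_subset by (metis rangeI subsetD)
  next
    fix x y assume "x \<in> closure ?D" "y \<in> closure ?D"
    then obtain s t where "\<And>n. s n \<in> ?D" "s \<longlonglongrightarrow> x" "\<And>n. t n \<in> ?D" "t \<longlonglongrightarrow> y"
      unfolding closure_sequential by blast
    moreover from this have "s n + t n \<in> ?D" for n
      using comb_add by (metis rangeE rangeI)
    ultimately show "x + y \<in> closure ?D"
      unfolding closure_sequential by (intro exI[of _ "\<lambda>n. s n + t n"]) (auto intro: tendsto_add)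
  next
    fix c :: real and x assume "x \<in> closure ?D"
    then obtain s where s: "\<And>n. s n \<in> ?D" "s \<longlonglongrightarrow> x"
      unfolding closure_sequential by blast
    have "c \<in> closure \<rat>"
      unfolding closure_approachable
    proof (intro allI impI)
      fix e :: real assume "0 < e"
      then obtain r where "r \<in> \<rat>" "c < r" "r < c + e"
        using Rats_dense_in_real[of c "c + e"] by auto
      then show "\<exists>r\<in>\<rat>. dist r c < e"
        by (intro bexI[of _ r]) (auto simp: dist_real_def)
    qed
    then obtain q where q: "\<And>n. q n \<in> \<rat>" "q \<longlonglongrightarrow> c"
      unfolding closure_sequential by blast
    have "q n *\<^sub>R s n \<in> ?D" for n
      using q(1)[of n] s(1)[of n] comb_scale by (metis Rats_cases rangeE rangeI)
    with s q show "c *\<^sub>R x \<in> closure ?D"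
      unfolding closure_sequential by (intro exI[of _ "\<lambda>n. q n *\<^sub>R s n"]) (auto intro: tendsto_scaleR)
  qed
  moreover have "A \<subseteq> closure ?D"
  proof
    fix x assume "x \<in> A"
    with a obtain n where "x = a n" by (metis insertI2 rangeE)
    then have "x = comb [(1, n)]" by (simp add: comb_def)
    then show "x \<in> closure ?D"
      using closure_subset by (metis rangeI subsetD)
  qed
  ultimately have "span A \<subseteq> closure ?D"
    by (simp add: span_minimal)
  moreover have "range (comb \<circ> from_nat) = ?D"
    by (metis image_comp surj_from_nat)
  ultimately show thesis
    using that by metis
qed

text \<open>The simple functions choose, among the first points of \<open>d\<close>, one nearest to
  \<open>u t\<close>. Only the distances to the \<open>d n\<close> have to be measurable.\<close>

lemma strongly_measurable_if_approximable:
  fixes u :: "'a \<Rightarrow> 'b::real_normed_vector" and d :: "nat \<Rightarrow> 'b"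
  assumes meas: "\<And>n. (\<lambda>t. norm (u t - d n)) \<in> borel_measurable M"
    and dense: "\<And>t. t \<in> space M \<Longrightarrow> u t \<in> closure (range d)"
  shows "strongly_measurable M u"
proof -
  \<comment> \<open>\<open>s n t\<close> is a point among \<open>d 0\<close>, ...,
    \<open>d n\<close> at minimal distance from \<open>u t\<close>; a later point replaces it only
    if strictly closer.\<close>
  define s where "s = rec_nat (\<lambda>t. d 0)
    (\<lambda>n sn t. if norm (u t - d (Suc n)) < norm (u t - sn t) then d (Suc n) else sn t)"
  have s_0: "s 0 = (\<lambda>t. d 0)"
    and s_Suc: "\<And>n. s (Suc n) = (\<lambda>t. if norm (u t - d (Suc n)) < norm (u t - s n t) then d (Suc n) else s n t)"
    unfolding s_def by simp_all
  have simple: "simple_function M (s n) \<and> (\<lambda>t. norm (u t - s n t)) \<in> borel_measurable M" for n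
  proof (induction n)
    case 0
    then show ?case by (simp add: s_0 meas)
  next
    case (Suc n)
    note [measurable] = meas Suc[THEN conjunct2]
    have "(\<lambda>t. norm (u t - s (Suc n) t)) = (\<lambda>t. min (norm (u t - d (Suc n))) (norm (u t - s n t)))"
      by (auto simp: s_Suc)
    then have "(\<lambda>t. norm (u t - s (Suc n) t)) \<in> borel_measurable M"
      by simp
    moreover have "simple_function M (s (Suc n))"
      unfolding s_Suc using Suc by (intro simple_function_If) auto
    ultimately show ?case by blast
  qed
  have close: "norm (u t - s n t) \<le> norm (u t - d k)" if "k \<le> n" for k n t
    using that
  proof (induction n)
    case 0
    then show ?case by (simp add: s_0)
  next
    case (Suc n)
    then show ?case by (cases "k = Suc n") (auto simp: s_Suc)
  qed
  have "(\<lambda>n. s n t) \<longlonglongrightarrow> u t" if "t \<in> space M" for t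
  proof (rule metric_LIMSEQ_I)
    fix \<epsilon> :: real assume "0 < \<epsilon>"
    with dense[OF that] obtain k where "dist (d k) (u t) < \<epsilon>"
      unfolding closure_approachable by blast
    then have "dist (s n t) (u t) < \<epsilon>" if "k \<le> n" for n
      using close[OF that, of t] by (simp add: dist_norm norm_minus_commute)
    then show "\<exists>k. \<forall>n\<ge>k. dist (s n t) (u t) < \<epsilon>" by blast
  qed
  with simple show ?thesis
    unfolding strongly_measurable_def by (intro exI[of _ s]) auto
qed

lemma Dw_strongly_measurable:
  fixes u :: "real \<Rightarrow> 'a::real_normed_vector"
  assumes u: "u \<in> Dw T"
  shows "strongly_measurable (lebesgue_on {0<..<T}) u"
proof -
  \<comment> \<open>Rationals outside \<open>{0..T}\<close> contribute only the value
    \<open>undefined\<close>, so the rational \<open>s\<close> found below may be any one to the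
    right of \<open>t\<close>.\<close>
  have "countable (u ` \<rat>)"
    by (intro countable_image countable_rat)
  then obtain d :: "nat \<Rightarrow> 'a" where d: "span (u ` \<rat>) \<subseteq> closure (range d)"
    by (rule countable_dense_in_span) (rule that)
  show ?thesis
  proof (rule strongly_measurable_if_approximable[OF Dw_norm_measurable[OF u]])
    fix t assume "t \<in> space (lebesgue_on {0<..<T})"
    then have t: "0 < t" "t < T" by (auto simp: space_restrict_space)
    \<comment> \<open>A functional vanishing on the span but not at \<open>u t\<close> would stay
      nonzero just after \<open>t\<close>, in particular at a rational time.\<close>
    have "u t \<in> closure (span (u ` \<rat>))"
    proof (rule ccontr)
      assume "u t \<notin> closure (span (u ` \<rat>))"
      with subspace_span obtain \<psi> :: "'a \<Rightarrow>\<^sub>L real"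
        where \<psi>: "\<And>x. x \<in> span (u ` \<rat>) \<Longrightarrow> blinfun_apply \<psi> x = 0" "blinfun_apply \<psi> (u t) \<noteq> 0"
        by (rule separate_from_subspace) (rule that, simp_all)
      have "((\<lambda>s. blinfun_apply \<psi> (u s)) \<longlongrightarrow> blinfun_apply \<psi> (u t)) (at_right t)"
        using Dw_right[OF u, of t] t by (auto simp: limitin_weak_topology_iff)
      then have "eventually (\<lambda>s. blinfun_apply \<psi> (u s) \<noteq> 0) (at_right t)"
        using \<psi>(2) by (rule tendsto_imp_eventually_ne)
      then obtain b where b: "t < b" "\<And>s. t < s \<Longrightarrow> s < b \<Longrightarrow> blinfun_apply \<psi> (u s) \<noteq> 0"
        by (auto simp: eventually_at_right_field)
      obtain s where "s \<in> \<rat>" "t < s" "s < b"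
        using Rats_dense_in_real[OF b(1)] by blast
      with b(2)[of s] \<psi>(1)[of "u s"] show False
        by (simp add: span_base)
    qed
    also have "\<dots> \<subseteq> closure (range d)"
      using d by (simp add: closure_minimal)
    finally show "u t \<in> closure (range d)" .
  qed
qed

lemma Dw_Linf_functions:
  assumes u: "u \<in> Dw T"
  shows "u \<in> Linf_functions T"
proof -
  obtain C where "\<forall>t\<in>{0..T}. norm (u t) \<le> C"
    using Dw_bounded[OF u] unfolding bounded_iff by blast
  then have "AE t in lebesgue_on {0<..<T}. norm (u t) \<le> C"
    by (intro AE_I2) (auto simp: space_restrict_space)
  with Dw_strongly_measurable[OF u] show ?thesis
    unfolding Linf_functions_def by blast
qed

text \<open>Bounded linear maps preserve weak limits. Since \<open>compose\<close> is
  \<open>undefined\<close> outside \<open>{0..T}\<close>, it is compared with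
  \<open>i \<circ> w\<close> only near \<open>t\<close>, on the relevant side.\<close>

lemma Dw_compose:
  assumes i: "bounded_linear i" and w: "w \<in> Dw T"
  shows "compose {0..T} i w \<in> Dw T"
proof -
  let ?u = "compose {0..T} i w"
  have "limitin weak_topology ?u (?u t) (at_right t)" if t: "t \<in> {0..<T}" for t
  proof (rule limitin_transform_eventually)
    show "limitin weak_topology (i \<circ> w) (?u t) (at_right t)"
      using limitin_weak_topology_bounded_linear[OF i Dw_right[OF w]] t by (simp add: compose_def)
    have "eventually (\<lambda>s. s \<in> {t<..<T}) (at_right t)"
      using t by (intro eventually_at_right_real) simp
    then show "eventually (\<lambda>s. (i \<circ> w) s = ?u s) (at_right t)"
      by eventually_elim (use t in \<open>simp add: compose_def\<close>)
  qed
  moreover have "\<exists>l. limitin weak_topology ?u l (at_left t)" if t: "t \<in> {0<..T}" for t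
  proof -
    obtain l where l: "limitin weak_topology w l (at_left t)"
      using Dw_left[OF w, of t] t by auto
    have "eventually (\<lambda>s. s \<in> {0<..<t}) (at_left t)"
      using t by (intro eventually_at_left_real) simp
    then have "eventually (\<lambda>s. (i \<circ> w) s = ?u s) (at_left t)"
      by eventually_elim (use t in \<open>simp add: compose_def\<close>)
    with limitin_weak_topology_bounded_linear[OF i l] show ?thesis
      by (blast intro: limitin_transform_eventually)
  qed
  ultimately show ?thesis
    by (auto simp: Dw_def compose_def)
qed

section \<open>Classes modulo equality almost everywhere\<close>

lemma ae_class_eqI:
  assumes "AE t in lebesgue_on {0<..<T}. u t = v t"
  shows "ae_class T u = ae_class T v"
proof -
  have "(AE t in lebesgue_on {0<..<T}. f t = u t) \<longleftrightarrow> (AE t in lebesgue_on {0<..<T}. f t = v t)" for f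
    using assms by (auto elim: eventually_elim2)
  then show ?thesis by (simp add: ae_class_def)
qed

lemma ae_class_eqD:
  assumes "ae_class T u = ae_class T v"
  shows "AE t in lebesgue_on {0<..<T}. u t = v t"
proof -
  have "u \<in> ae_class T u" by (simp add: ae_class_def)
  with assms show ?thesis by (simp add: ae_class_def)
qed

section \<open>Lifting along the embedding\<close>

text \<open>A nondegenerate interval has positive measure and so cannot lie in the exceptional null
  set. This yields good times arbitrarily close to the right of a given time.\<close>

lemma AE_lebesgue_on_interval_witness:
  fixes a b T :: real
  assumes P: "AE t in lebesgue_on {0<..<T}. P t" and ab: "0 \<le> a" "a < b" "b \<le> T"
  obtains t where "a < t" "t < b" "P t"
proof -
  have "AE t in lebesgue. t \<in> {0<..<T} \<longrightarrow> P t"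
    using P by (subst (asm) AE_restrict_space_iff) auto
  then obtain N where N: "\<And>t. t \<in> space lebesgue - N \<Longrightarrow> t \<in> {0<..<T} \<longrightarrow> P t"
      "N \<in> null_sets lebesgue"
    by (rule AE_E3) (rule that, simp_all)
  have "\<exists>t\<in>{a<..<b}. P t"
  proof (rule ccontr)
    assume "\<not> (\<exists>t\<in>{a<..<b}. P t)"
    then have "{a<..<b} \<subseteq> N"
      using N(1) ab by (force simp: subset_iff)
    with N(2) have "{a<..<b} \<in> null_sets lebesgue"
      using null_sets_subset[of N lebesgue "{a<..<b}"] by simp
    then have "emeasure lborel {a<..<b} = 0"
      by auto
    with ab show False by simp
  qed
  with that show thesis by auto
qed

lemma limitin_mono_filter: "limitin X f l F \<Longrightarrow> G \<le> F \<Longrightarrow> limitin X f l G"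
  by (auto simp: limitin_def intro: filter_leD)

text \<open>The lifting is used twice: first along good times, to place every value before
  \<open>T\<close> in the ball of radius \<open>C\<close>, then along full one-sided neighbourhoods,
  where the bound now holds everywhere. The value \<open>x\<close> at \<open>T\<close> is prescribed
  by the caller.\<close>

lemma Dw_lift:
  fixes i :: "'e::real_normed_vector \<Rightarrow> 'f::real_normed_vector"
  assumes refl: "reflexive_space TYPE('e)" and i: "bounded_linear i" "inj i"
    and u: "u \<in> Dw T" and v: "v \<in> Linf_functions T"
    and uv: "AE t in lebesgue_on {0<..<T}. u t = i (v t)"
  obtains w where "w \<in> Dw T" "\<And>t. 0 \<le> t \<Longrightarrow> t < T \<Longrightarrow> i (w t) = u t" "0 \<le> T \<Longrightarrow> w T = x"
proof -
  obtain C where "AE t in lebesgue_on {0<..<T}. norm (v t) \<le> C"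
    using v by (auto simp: Linf_functions_def)
  then have good: "AE t in lebesgue_on {0<..<T}. i (v t) = u t \<and> norm (v t) \<le> C"
    using uv by eventually_elim simp
  have "\<exists>e. i e = u t \<and> norm e \<le> C" if t: "0 \<le> t" "t < T" for t
  proof -
    let ?S = "{s. t < s \<and> i (v s) = u s \<and> norm (v s) \<le> C}"
    \<comment> \<open>The right-hand neighbourhoods of \<open>t\<close> restricted to good times;
      this filter is nontrivial because good times accumulate at \<open>t\<close>.\<close>
    let ?F = "at t within ?S"
    have "t islimpt ?S"
      unfolding islimpt_approachable
    proof (intro allI impI)
      fix \<epsilon> :: real assume "0 < \<epsilon>"
      then obtain s where "t < s" "s < min (t + \<epsilon>) T" "i (v s) = u s \<and> norm (v s) \<le> C"
        using AE_lebesgue_on_interval_witness[OF good, of t "min (t + \<epsilon>) T"] t by auto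
      then show "\<exists>s\<in>?S. s \<noteq> t \<and> dist s t < \<epsilon>"
        by (intro bexI[of _ s]) (auto simp: dist_real_def)
    qed
    then have F: "?F \<noteq> bot"
      by (simp add: trivial_limit_within)
    have S: "eventually (\<lambda>s. s \<in> ?S) ?F"
      by (simp add: eventually_at_topological) blast
    then have "eventually (\<lambda>s. u s = (i \<circ> v) s) ?F" "eventually (\<lambda>s. norm (v s) \<le> C) ?F"
      by (auto elim: eventually_mono)
    moreover have "limitin weak_topology u (u t) ?F"
      using Dw_right[OF u t] by (rule limitin_mono_filter) (auto intro: at_le)
    ultimately have "limitin weak_topology (i \<circ> v) (u t) ?F" "eventually (\<lambda>s. norm (v s) \<le> C) ?F"
      by (auto intro: limitin_transform_eventually)
    from weak_limit_lift[OF refl i F this(2,1)] show ?thesis by metis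
  qed
  then obtain w0 where w0: "\<And>t. 0 \<le> t \<Longrightarrow> t < T \<Longrightarrow> i (w0 t) = u t \<and> norm (w0 t) \<le> C"
    by metis
  \<comment> \<open>Changing the value at \<open>T\<close> affects no one-sided limit in the
    definition of \<open>Dw\<close>.\<close>
  define w where "w = restrict (w0(T := x)) {0..T}"
  have w: "i (w t) = u t" "norm (w t) \<le> C" if "0 \<le> t" "t < T" for t
    using w0[OF that] that by (auto simp: w_def)
  \<comment> \<open>Handles right and left limits together: both filters eventually stay in
    \<open>[0,T)\<close>, where \<open>w\<close> is bounded by \<open>C\<close> and lifts
    \<open>u\<close>.\<close>
  have lift: "\<exists>e. i e = l \<and> limitin weak_topology w e F"
    if lim: "limitin weak_topology u l F" and F: "F \<noteq> bot" "eventually (\<lambda>s. 0 \<le> s \<and> s < T) F" for l F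
  proof -
    from F(2) have "eventually (\<lambda>s. u s = (i \<circ> w) s) F"
      by eventually_elim (simp add: w)
    then have "limitin weak_topology (i \<circ> w) l F"
      using lim by (rule limitin_transform_eventually)
    moreover from F(2) have "eventually (\<lambda>s. norm (w s) \<le> C) F"
      by eventually_elim (simp add: w)
    ultimately show ?thesis
      using weak_limit_lift[OF refl i F(1), of w C l] by metis
  qed
  show thesis
  proof
    have "limitin weak_topology w (w t) (at_right t)" if t: "0 \<le> t" "t < T" for t
    proof -
      have "eventually (\<lambda>s. s \<in> {t<..<T}) (at_right t)"
        using t by (intro eventually_at_right_real) simp
      then have "eventually (\<lambda>s. 0 \<le> s \<and> s < T) (at_right t)"
        by eventually_elim (use t in simp)
      then obtain e where e: "i e = u t" "limitin weak_topology w e (at_right t)"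
        using lift[OF Dw_right[OF u t] trivial_limit_at_right_real] by blast
      moreover have "e = w t"
        using injD[OF i(2), of e "w t"] e(1) w(1)[OF t] by simp
      ultimately show ?thesis by simp
    qed
    moreover have "\<exists>e. limitin weak_topology w e (at_left t)" if t: "0 < t" "t \<le> T" for t
    proof -
      obtain l where l: "limitin weak_topology u l (at_left t)"
        using Dw_left[OF u t] by blast
      have "eventually (\<lambda>s. s \<in> {0<..<t}) (at_left t)"
        using t by (intro eventually_at_left_real) simp
      then have "eventually (\<lambda>s. 0 \<le> s \<and> s < T) (at_left t)"
        by eventually_elim (use t in simp)
      then show ?thesis
        using lift[OF l trivial_limit_at_left_real] by blast
    qed
    ultimately show "w \<in> Dw T"
      by (auto simp: Dw_def w_def)
  qed (use w in \<open>auto simp: w_def\<close>)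
qed

(* The first conjunct is the equality of sets of classes modulo equality almost everywhere, the
   second one the equality of sets of functions on [0,T]. In the latter the value at T has to lie
   in E: a weakly cadlag function may take any value at T, and the L^infinity condition does not
   see this point. *)
theorem lemma4p7:
  fixes i :: "'e::banach \<Rightarrow> 'f::banach" and T :: real
  assumes "reflexive_space TYPE('e)"
    and "dense_continuous_embedding i"
    and "T > 0"
  shows "Linf_via T i \<inter> ae_class T ` Dw T = (\<lambda>w. ae_class T (i \<circ> w)) ` Dw T
       \<and> {u \<in> Dw T. ae_class T u \<in> Linf_via T i \<and> u T \<in> range i} = compose {0..T} i ` Dw T"
proof -
  have i: "bounded_linear i" "inj i"
    using assms(2) by (auto simp: dense_continuous_embedding_def)
  have lift: "\<exists>w\<in>Dw T. (\<forall>t\<in>{0..<T}. i (w t) = u t) \<and> w T = x"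
    if u: "u \<in> Dw T" and c: "ae_class T u \<in> Linf_via T i" for u x
  proof -
    from c obtain v where v: "v \<in> Linf_functions T" and "ae_class T u = ae_class T (i \<circ> v)"
      by (auto simp: Linf_via_def)
    from ae_class_eqD[OF this(2)] have "AE t in lebesgue_on {0<..<T}. u t = i (v t)"
      by simp
    from Dw_lift[OF assms(1) i u v this, of x] \<open>T > 0\<close> show ?thesis
      by (metis atLeastLessThan_iff less_imp_le)
  qed
  have via: "ae_class T (i \<circ> w) \<in> Linf_via T i" if "w \<in> Dw T" for w
    using Dw_Linf_functions[OF that] by (simp add: Linf_via_def)
  \<comment> \<open>The two representatives can differ only outside \<open>{0..T}\<close>, which the
    classes do not see.\<close>
  have cls: "ae_class T (compose {0..T} i w) = ae_class T (i \<circ> w)" for w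
    by (intro ae_class_eqI AE_I2) (auto simp: compose_def space_restrict_space)
  have "Linf_via T i \<inter> ae_class T ` Dw T = (\<lambda>w. ae_class T (i \<circ> w)) ` Dw T"
  proof (intro equalityI subsetI)
    fix c assume "c \<in> Linf_via T i \<inter> ae_class T ` Dw T"
    then obtain u where u: "u \<in> Dw T" "c = ae_class T u" "ae_class T u \<in> Linf_via T i"
      by blast
    with lift obtain w where w: "w \<in> Dw T" "\<forall>t\<in>{0..<T}. i (w t) = u t"
      by blast
    from w(2) have "ae_class T (i \<circ> w) = ae_class T u"
      by (intro ae_class_eqI AE_I2) (auto simp: space_restrict_space)
    with u w show "c \<in> (\<lambda>w. ae_class T (i \<circ> w)) ` Dw T"
      by force
  next
    fix c assume "c \<in> (\<lambda>w. ae_class T (i \<circ> w)) ` Dw T"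
    then obtain w where w: "w \<in> Dw T" "c = ae_class T (i \<circ> w)" by blast
    with cls[of w] have "c = ae_class T (compose {0..T} i w)" by simp
    with w via[OF w(1)] Dw_compose[OF i(1) w(1)] show "c \<in> Linf_via T i \<inter> ae_class T ` Dw T"
      by blast
  qed
  moreover have "{u \<in> Dw T. ae_class T u \<in> Linf_via T i \<and> u T \<in> range i} = compose {0..T} i ` Dw T"
  proof (intro equalityI subsetI)
    fix u assume "u \<in> {u \<in> Dw T. ae_class T u \<in> Linf_via T i \<and> u T \<in> range i}"
    then obtain x where u: "u \<in> Dw T" "ae_class T u \<in> Linf_via T i" "u T = i x"
      by blast
    \<comment> \<open>Here the free value at \<open>T\<close> is taken to be the preimage
      \<open>x\<close> of \<open>u T\<close>, so that the lift matches \<open>u\<close> at the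
      endpoint too.\<close>
    with lift obtain w where w: "w \<in> Dw T" "\<forall>t\<in>{0..<T}. i (w t) = u t" "w T = x"
      by blast
    have "u = compose {0..T} i w"
    proof (rule extensionalityI[of _ "{0..T}"])
      show "u \<in> extensional {0..T}"
        using u(1) by (simp add: Dw_def)
      fix t assume "t \<in> {0..T}"
      then show "u t = compose {0..T} i w t"
        using w u(3) by (cases "t = T") (auto simp: compose_def)
    qed simp
    with w(1) show "u \<in> compose {0..T} i ` Dw T" by blast
  next
    fix u assume "u \<in> compose {0..T} i ` Dw T"
    then obtain w where w: "w \<in> Dw T" "u = compose {0..T} i w" by blast
    with \<open>T > 0\<close> have "u T \<in> range i" by (simp add: compose_def)
    with w via[OF w(1)] cls[of w] Dw_compose[OF i(1) w(1)]
    show "u \<in> {u \<in> Dw T. ae_class T u \<in> Linf_via T i \<and> u T \<in> range i}" by simp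
  qed
  ultimately show ?thesis ..
qed

end
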